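(* Consider the SISO system $$y(k)+a_ny(k-1)+\dots+a_1y(k-n)=b_nu(k-1)+\dots+b_1u(k-n),$$ where the polynomials $z^n+a_nz^{n-1}+\dots+a_2z+a_1$ and $b_nz^{n-1}+\dots+b_2z+b_1$ are coprime, and let $\mathcal{A},\mathcal{B}$, the data matrices $U_{0,1,T},\hat X_{0,T},\hat X_{1,T}$, the controller and the closed-loop system be as in the context. Suppose that $$\operatorname{rank}\begin{bmatrix}U_{0,1,T}\\ \hat X_{0,T}\end{bmatrix}=2n+1 .$$ Then the following properties hold. (i) For every controller $$y^c(k)+c_ny^c(k-1)+\dots+c_1y^c(k-n)=d_nu^c(k-1)+\dots+d_1u^c(k-n)\qquad(\mathrm{C})$$ with coefficient vector $\mathcal{K}:=[d_1\ \cdots\ d_n\ \ -c_1\ \cdots\ -c_n]$, the closed-loop system $\chi(k+1)=(\mathcal{A}+\mathcal{B}\mathcal{K})\chi(k)$ has the equivalent representation $$\chi(k+1)=\hat X_{1,T}\,G_{\mathcal{K}}\,\chi(k),$$ where $G_{\mathcal{K}}$ is a $T\times 2n$ matrix such that $$\begin{bmatrix}\mathcal{K}\\ I_{2n}\end{bmatrix}=\begin{bmatrix}U_{0,1,T}\\ \hat X_{0,T}\end{bmatrix}G_{\mathcal{K}}$$ (such a matrix exists, and any such matrix satisfies $\mathcal{A}+\mathcal{B}\mathcal{K}=\hat X_{1,T}G_{\mathcal{K}}$). (ii) Any matrix $\mathcal{Q}\in\mathbb{R}^{T\times 2n}$ satisfying $$\begin{bmatrix}\hat X_{0,T}\mathcal{Q}&\hat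 X_{1,T}\mathcal{Q}\\ \mathcal{Q}^\top\hat X_{1,T}^\top&\hat X_{0,T}\mathcal{Q}\end{bmatrix}\succ0\qquad(\ast)$$ is such that the controller (C) with coefficients given by $$\mathcal{K}=U_{0,1,T}\,\mathcal{Q}\,(\hat X_{0,T}\mathcal{Q})^{-1}\qquad(\ast\ast)$$ stabilizes the system. Conversely, any controller of the form (C) that stabilizes the system must have coefficients $\mathcal{K}$ given by $(\ast\ast)$ with $\mathcal{Q}$ a solution of $(\ast)$.
   Context: State: $\chi(k)=\operatorname{col}(y(k-n),\dots,y(k-1),u(k-n),\dots,u(k-1))\in\mathbb{R}^{2n}$. The system is written $\chi(k+1)=\mathcal{A}\chi(k)+\mathcal{B}u(k)$, where $\mathcal{A}\in\mathbb{R}^{2n\times2n}$ and $\mathcal{B}\in\mathbb{R}^{2n}$ are defined, in coordinates $\chi=(\chi_1,\dots,\chi_{2n})$, by: $\chi_i^+=\chi_{i+1}$ for $1\le i\le n-1$; $\chi_n^+=-\sum_{i=1}^na_i\chi_i+\sum_{i=1}^nb_i\chi_{n+i}$; $\chi_{n+i}^+=\chi_{n+i+1}$ for $1\le i\le n-1$; $\chi_{2n}^+=u$. Data: scalar sequences $u_d(k),y_d(k)$, $k=-n,\dots,T-1$, with the difference equation holding for $k=0,\dots,T-1$; $\chi_d(k)=\operatorname{col}(y_d(k-n),\dots,y_d(k-1),u_d(k-n),\dots,u_d(k-1))$ for $k=0,\dots,T$ (so $\chi_d(k+1)=\mathcal{A}\chi_d(k)+\mathcal{B}u_d(k)$). $U_{0,1,T}=[u_d(0)\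 \cdots\ u_d(T-1)]$, $\hat X_{0,T}=[\chi_d(0)\ \cdots\ \chi_d(T-1)]$, $\hat X_{1,T}=[\chi_d(1)\ \cdots\ \chi_d(T)]$. Interconnection: the controller (C) is connected to the system by $u^c(k)=y(k)$, $y^c(k)=u(k)$, giving the closed-loop system $\chi(k+1)=(\mathcal{A}+\mathcal{B}\mathcal{K})\chi(k)$ (the matrix $\mathcal{A}$ with its last row replaced by $\mathcal{K}$). The controller stabilizes the system if this closed-loop system is asymptotically stable, i.e. all eigenvalues of $\mathcal{A}+\mathcal{B}\mathcal{K}$ have modulus strictly less than $1$. $M\succ0$ means $M$ is symmetric and positive definite. *)

theory Defs
  imports
    Complex_Main
    "HOL-Computational_Algebra.Polynomial_Factorial"
    "Jordan_Normal_Form.DL_Rank"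
    "Jordan_Normal_Form.Char_Poly"
    "Jordan_Normal_Form.Gauss_Jordan_Elimination"
begin

text \<open>
  Coefficients \<open>a\<^sub>1, \<dots>, a\<^sub>n\<close> are the values of a function at \<open>1, \<dots>, n\<close>; signals are functions on
  \<^typ>\<open>int\<close>. Matrices and vectors are indexed from zero: component \<open>j\<close> of a vector is the
  textbook component \<open>j + 1\<close>.
\<close>

definition den_poly :: "nat \<Rightarrow> (nat \<Rightarrow> real) \<Rightarrow> real poly" where
  "den_poly n a = monom 1 n + (\<Sum>i=1..n. monom (a i) (i - 1))"

definition num_poly :: "nat \<Rightarrow> (nat \<Rightarrow> real) \<Rightarrow> real poly" where
  "num_poly n b = (\<Sum>i=1..n. monom (b i) (i - 1))"

text \<open>
  \<open>v k + a\<^sub>n v (k-1) + \<dots> + a\<^sub>1 v (k-n) = b\<^sub>n w (k-1) + \<dots> + b\<^sub>1 w (k-n)\<close>, with input \<open>w\<close> and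
  output \<open>v\<close>. The plant and the controller are both of this form; for the plant \<open>w = u\<close>, \<open>v = y\<close>,
  and for the interconnected controller \<open>w = y\<close>, \<open>v = u\<close>.
\<close>

definition difference_eq ::
  "nat \<Rightarrow> (nat \<Rightarrow> real) \<Rightarrow> (nat \<Rightarrow> real) \<Rightarrow> (int \<Rightarrow> real) \<Rightarrow> (int \<Rightarrow> real) \<Rightarrow> int \<Rightarrow> bool" where
  "difference_eq n a b w v k \<longleftrightarrow>
     v k + (\<Sum>i=1..n. a i * v (k - int n + int i - 1))
       = (\<Sum>i=1..n. b i * w (k - int n + int i - 1))"

definition state :: "nat \<Rightarrow> (int \<Rightarrow> real) \<Rightarrow> (int \<Rightarrow> real) \<Rightarrow> int \<Rightarrow> real vec" where
  "state n u y k = vec (2 * n)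
     (\<lambda>j. if j < n then y (k - int n + int j) else u (k - int n + int (j - n)))"

definition sys_A :: "nat \<Rightarrow> (nat \<Rightarrow> real) \<Rightarrow> (nat \<Rightarrow> real) \<Rightarrow> real mat" where
  "sys_A n a b = mat (2 * n) (2 * n) (\<lambda>(i, j).
     if i = n - 1 then (if j < n then - a (j + 1) else b (j - n + 1))
     else if i = 2 * n - 1 then 0
     else if j = i + 1 then 1 else 0)"

definition sys_B :: "nat \<Rightarrow> real mat" where
  "sys_B n = mat (2 * n) 1 (\<lambda>(i, j). if i = 2 * n - 1 then 1 else 0)"

definition controller_row :: "nat \<Rightarrow> (nat \<Rightarrow> real) \<Rightarrow> (nat \<Rightarrow> real) \<Rightarrow> real mat" where
  "controller_row n c d = mat 1 (2 * n) (\<lambda>(i, j). if j < n then d (j + 1) else - c (j - n + 1))"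

definition closed_loop ::
  "nat \<Rightarrow> (nat \<Rightarrow> real) \<Rightarrow> (nat \<Rightarrow> real) \<Rightarrow> (nat \<Rightarrow> real) \<Rightarrow> (nat \<Rightarrow> real) \<Rightarrow> real mat" where
  "closed_loop n a b c d = sys_A n a b + sys_B n * controller_row n c d"

definition trajectory :: "real mat \<Rightarrow> (nat \<Rightarrow> real vec) \<Rightarrow> bool" where
  "trajectory M \<chi> \<longleftrightarrow> (\<forall>k. \<chi> k \<in> carrier_vec (dim_col M) \<and> \<chi> (Suc k) = M *\<^sub>v \<chi> k)"

definition asymptotically_stable :: "real mat \<Rightarrow> bool" where
  "asymptotically_stable M \<longleftrightarrow> (\<forall>z. eigenvalue (map_mat complex_of_real M) z \<longrightarrow> cmod z < 1)"

definition stabilizes ::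
  "nat \<Rightarrow> (nat \<Rightarrow> real) \<Rightarrow> (nat \<Rightarrow> real) \<Rightarrow> (nat \<Rightarrow> real) \<Rightarrow> (nat \<Rightarrow> real) \<Rightarrow> bool" where
  "stabilizes n a b c d \<longleftrightarrow> asymptotically_stable (closed_loop n a b c d)"

definition pos_def_mat :: "real mat \<Rightarrow> bool" where
  "pos_def_mat M \<longleftrightarrow> M \<in> carrier_mat (dim_row M) (dim_row M) \<and> M\<^sup>T = M \<and>
     (\<forall>v \<in> carrier_vec (dim_row M). v \<noteq> 0\<^sub>v (dim_row M) \<longrightarrow> v \<bullet> (M *\<^sub>v v) > 0)"

definition data_U :: "nat \<Rightarrow> (int \<Rightarrow> real) \<Rightarrow> real mat" where
  "data_U T u = mat 1 T (\<lambda>(i, k). u (int k))"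

definition data_X0 :: "nat \<Rightarrow> nat \<Rightarrow> (int \<Rightarrow> real) \<Rightarrow> (int \<Rightarrow> real) \<Rightarrow> real mat" where
  "data_X0 n T u y = mat_of_cols (2 * n) (map (\<lambda>k. state n u y (int k)) [0..<T])"

definition data_X1 :: "nat \<Rightarrow> nat \<Rightarrow> (int \<Rightarrow> real) \<Rightarrow> (int \<Rightarrow> real) \<Rightarrow> real mat" where
  "data_X1 n T u y = mat_of_cols (2 * n) (map (\<lambda>k. state n u y (int k + 1)) [0..<T])"

definition lmi :: "real mat \<Rightarrow> real mat \<Rightarrow> real mat \<Rightarrow> bool" where
  "lmi X0 X1 Q \<longleftrightarrow> pos_def_mat (four_block_mat (X0 * Q) (X1 * Q) (Q\<^sup>T * X1\<^sup>T) (X0 * Q))"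

text \<open>
  Only meaningful if \<open>X0 * Q\<close> is invertible, since \<^const>\<open>mat_inverse\<close> is \<^const>\<open>None\<close> otherwise.
\<close>

definition gain_of :: "real mat \<Rightarrow> real mat \<Rightarrow> real mat \<Rightarrow> real mat" where
  "gain_of U X0 Q = U * Q * the (mat_inverse (X0 * Q))"

text \<open>
  The matrices above realise the difference equations: the plant alone is
  \<open>\<chi>(k+1) = A \<chi>(k) + B u(k)\<close>, and its interconnection with the controller is the closed loop.
\<close>

lemma sum_split_2n:
  fixes f :: "nat \<Rightarrow> real"
  shows "(\<Sum>j<2*n. f j) = (\<Sum>i=1..n. f (i - 1)) + (\<Sum>i=1..n. f (n + i - 1))"
proof -
  have "(\<Sum>j<2*n. f j) = (\<Sum>j<n. f j) + (\<Sum>j=n..<n+n. f j)"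
    by (metis atLeast0LessThan le_add1 mult_2 sum.atLeastLessThan_concat zero_le)
  also have "(\<Sum>j<n. f j) = (\<Sum>i=1..n. f (i - 1))"
    by (rule sum.reindex_bij_witness[of _ "\<lambda>i. i - 1" Suc]) auto
  also have "(\<Sum>j=n..<n+n. f j) = (\<Sum>i=1..n. f (n + i - 1))"
    by (rule sum.reindex_bij_witness[of _ "\<lambda>i. n + i - 1" "\<lambda>j. j - n + 1"]) auto
  finally show ?thesis .
qed

lemma sum_last_row:
  fixes \<alpha> \<beta> :: "nat \<Rightarrow> real"
  shows "(\<Sum>j<2*n. (if j < n then - \<alpha> (j + 1) else \<beta> (j - n + 1)) * state n u y k $ j)
    = (\<Sum>i=1..n. \<beta> i * u (k - int n + int i - 1)) - (\<Sum>i=1..n. \<alpha> i * y (k - int n + int i - 1))"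
proof -
  have 1: "(\<Sum>i=1..n. (if i - 1 < n then - \<alpha> (i - 1 + 1) else \<beta> (i - 1 - n + 1)) * state n u y k $ (i - 1))
      = (\<Sum>i=1..n. - (\<alpha> i * y (k - int n + int i - 1)))"
    by (rule sum.cong) (auto simp: state_def of_nat_diff algebra_simps)
  have 2: "(\<Sum>i=1..n. (if n + i - 1 < n then - \<alpha> (n + i - 1 + 1) else \<beta> (n + i - 1 - n + 1))
        * state n u y k $ (n + i - 1))
      = (\<Sum>i=1..n. \<beta> i * u (k - int n + int i - 1))"
    by (rule sum.cong) (auto simp: state_def of_nat_diff algebra_simps)
  show ?thesis unfolding sum_split_2n 1 2 by (simp add: sum_negf)
qed

lemma sys_A_mult_state:
  assumes "n \<ge> 1" "i < 2 * n"
  shows "(sys_A n a b *\<^sub>v state n u y k) $ i =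
    (if i = n - 1 then (\<Sum>i=1..n. b i * u (k - int n + int i - 1)) - (\<Sum>i=1..n. a i * y (k - int n + int i - 1))
     else if i = 2 * n - 1 then 0 else state n u y k $ (i + 1))"
proof -
  have "(sys_A n a b *\<^sub>v state n u y k) $ i = (\<Sum>j<2*n. sys_A n a b $$ (i, j) * state n u y k $ j)"
    using assms by (simp add: sys_A_def state_def scalar_prod_def atLeast0LessThan)
  also have "\<dots> = (\<Sum>j<2*n. (if i = n - 1 then (if j < n then - a (j + 1) else b (j - n + 1))
     else if i = 2 * n - 1 then 0 else if j = i + 1 then 1 else 0) * state n u y k $ j)"
    using assms by (intro sum.cong) (auto simp: sys_A_def)
  also have "\<dots> = (if i = n - 1 then (\<Sum>i=1..n. b i * u (k - int n + int i - 1)) - (\<Sum>i=1..n. a i * y (k - int n + int i - 1))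
     else if i = 2 * n - 1 then 0 else state n u y k $ (i + 1))"
  proof -
    consider "i = n - 1" | "i \<noteq> n - 1" "i = 2 * n - 1" | "i \<noteq> n - 1" "i \<noteq> 2 * n - 1" by blast
    then show ?thesis
    proof cases
      case 1
      then show ?thesis using sum_last_row[of n a b u y k] by simp
    next
      case 3
      then have "i + 1 < 2 * n" using assms by simp
      then show ?thesis using 3 by (simp add: if_distrib[of "\<lambda>x. x * _"] cong: if_cong)
    qed simp
  qed
  finally show ?thesis .
qed

lemma controller_row_mult_state:
  "(controller_row n c d *\<^sub>v state n u y k) $ 0
    = (\<Sum>i=1..n. d i * y (k - int n + int i - 1)) - (\<Sum>i=1..n. c i * u (k - int n + int i - 1))"
proof -
  have "(controller_row n c d *\<^sub>v state n u y k) $ 0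
      = (\<Sum>j<2*n. controller_row n c d $$ (0, j) * state n u y k $ j)"
    by (simp add: controller_row_def state_def scalar_prod_def atLeast0LessThan)
  also have "\<dots> = (\<Sum>j<2*n. (if j < n then - (- d (j + 1)) else - c (j - n + 1)) * state n u y k $ j)"
    by (intro sum.cong) (auto simp: controller_row_def)
  also have "\<dots> = (\<Sum>i=1..n. d i * y (k - int n + int i - 1)) - (\<Sum>i=1..n. c i * u (k - int n + int i - 1))"
    using sum_last_row[of n "\<lambda>i. - d i" "\<lambda>i. - c i" u y k] by (simp add: sum_negf)
  finally show ?thesis .
qed

lemma state_step_iff:
  assumes "n \<ge> 1" "w \<in> carrier_vec 1"
  shows "state n u y (k + 1) = sys_A n a b *\<^sub>v state n u y k + sys_B n *\<^sub>v w
    \<longleftrightarrow> difference_eq n a b u y k \<and> u k = w $ 0" (is "?L \<longleftrightarrow> ?R")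
proof -
  let ?rhs = "\<lambda>i. (sys_A n a b *\<^sub>v state n u y k) $ i + (if i = 2 * n - 1 then w $ 0 else 0)"
  have B: "(sys_B n *\<^sub>v w) $ i = (if i = 2 * n - 1 then w $ 0 else 0)" if "i < 2 * n" for i
    using that assms by (simp add: sys_B_def scalar_prod_def)
  have "?L \<longleftrightarrow> (\<forall>i < 2*n. state n u y (k + 1) $ i = ?rhs i)"
    using B by (auto simp: vec_eq_iff state_def sys_A_def sys_B_def)
  also have "\<dots> \<longleftrightarrow> state n u y (k + 1) $ (n - 1) = ?rhs (n - 1)
      \<and> state n u y (k + 1) $ (2 * n - 1) = ?rhs (2 * n - 1)"
  proof -
    have "state n u y (k + 1) $ i = ?rhs i" if "i < 2 * n" "i \<noteq> n - 1" "i \<noteq> 2 * n - 1" for i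
      unfolding sys_A_mult_state[OF assms(1) that(1)]
      using that by (auto simp: state_def of_nat_diff algebra_simps)
    moreover have "n - 1 < 2 * n" "2 * n - 1 < 2 * n" using assms by auto
    ultimately show ?thesis by fast
  qed
  also have "\<dots> \<longleftrightarrow> ?R"
  proof -
    have l: "n - 1 < 2 * n" "2 * n - 1 < 2 * n" "n - 1 \<noteq> 2 * n - 1" using assms by auto
    have "state n u y (k + 1) $ (n - 1) = y k" "state n u y (k + 1) $ (2 * n - 1) = u k"
      using assms by (auto simp: state_def of_nat_diff algebra_simps)
    then show ?thesis
      using l by (auto simp: sys_A_mult_state[OF assms(1)] difference_eq_def)
  qed
  finally show ?thesis .
qed

lemma closed_loop_step_iff:
  assumes "n \<ge> 1"
  shows "state n u y (k + 1) = closed_loop n a b c d *\<^sub>v state n u y k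
    \<longleftrightarrow> difference_eq n a b u y k \<and> difference_eq n c d y u k"
proof -
  have c: "sys_A n a b \<in> carrier_mat (2*n) (2*n)" "sys_B n \<in> carrier_mat (2*n) 1"
    "controller_row n c d \<in> carrier_mat 1 (2*n)" "state n u y k \<in> carrier_vec (2*n)"
    by (auto simp: sys_A_def sys_B_def controller_row_def state_def)
  have "closed_loop n a b c d *\<^sub>v state n u y k
      = sys_A n a b *\<^sub>v state n u y k + sys_B n *\<^sub>v (controller_row n c d *\<^sub>v state n u y k)"
    unfolding closed_loop_def using c
    by (simp add: add_mult_distrib_mat_vec[of _ "2*n" "2*n"] assoc_mult_mat_vec[of _ "2*n" 1 _ "2*n"])
  moreover have "controller_row n c d *\<^sub>v state n u y k \<in> carrier_vec 1" using c by simp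
  ultimately show ?thesis
    using state_step_iff[OF assms, of "controller_row n c d *\<^sub>v state n u y k"]
    by (auto simp: controller_row_mult_state difference_eq_def)
qed

end

theory Submission
  imports Defs "Jordan_Normal_Form.Spectral_Radius"
begin

text \<open>Write A, B for the plant matrices, K for a controller row and M = A + B K for the closed
  loop. The data satisfy X1 = A X0 + B U (\<open>data_X1_eq\<close>). The rank hypothesis says that
  the stacked matrix [U; X0] has full row rank, hence a right inverse
  (\<open>full_row_rank_right_inverse\<close>). So [K; I] = [U; X0] G is solvable for every K, and
  any solution gives X1 G = A (X0 G) + B (U G) = A + B K. The unknown plant is thereby expressed
  through data.

  For the matrix inequality put P = X0 Q. Its diagonal block forces P to be positive definite, so G
  = Q P^-1 is defined; it satisfies X0 G = I and U G = K for the gain K of Q. Hence X1 Q = M P, and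
  the inequality concerns the block matrix [P, M P; (M P)^T, P]. Completing the square
  (\<open>pos_def_block_iff\<close>) makes it equivalent to P > 0 together with M P M^T < P, the
  discrete Lyapunov inequality for M^T. This bounds the eigenvalues of M^T, which are those of M
  (\<open>asymptotically_stable_if_form_decreases\<close>,
  \<open>asymptotically_stable_transpose\<close>).

  Conversely, if M is stable, a truncated Lyapunov sum for M^T provides such a P
  (\<open>asymptotically_stable_form_exists\<close>). With G a solution for K, the matrix Q = G P
  satisfies X0 Q = P, X1 Q = M P and U Q = K P, so it solves the inequality and has gain K.\<close>

section \<open>Stacked matrices and full row rank\<close>

lemma append_rows_mult:
  fixes A B C :: "'a :: semiring_0 mat"
  assumes "A \<in> carrier_mat r1 m" "B \<in> carrier_mat r2 m" "C \<in> carrier_mat m k"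
  shows "(A @\<^sub>r B) * C = (A * C) @\<^sub>r (B * C)"
proof (rule eq_matI)
  fix i j assume "i < dim_row ((A * C) @\<^sub>r (B * C))" "j < dim_col ((A * C) @\<^sub>r (B * C))"
  then show "((A @\<^sub>r B) * C) $$ (i, j) = ((A * C) @\<^sub>r (B * C)) $$ (i, j)"
    using assms by (auto simp: append_rows_def scalar_prod_def intro!: sum.cong)
qed (use assms in \<open>auto simp: append_rows_def\<close>)

lemma append_rows_inject:
  fixes A A' B B' :: "'a :: zero mat"
  assumes "A \<in> carrier_mat r1 m" "A' \<in> carrier_mat r1 m"
    and "B \<in> carrier_mat r2 m" "B' \<in> carrier_mat r2 m"
  shows "A @\<^sub>r B = A' @\<^sub>r B' \<longleftrightarrow> A = A' \<and> B = B'"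
proof (intro iffI conjI)
  assume eq: "A @\<^sub>r B = A' @\<^sub>r B'"
  show "A = A'"
  proof (rule eq_matI)
    fix i j assume "i < dim_row A'" "j < dim_col A'"
    then show "A $$ (i, j) = A' $$ (i, j)"
      using arg_cong[OF eq, of "\<lambda>M. M $$ (i, j)"] assms by (simp add: append_rows_def)
  qed (use assms in auto)
  show "B = B'"
  proof (rule eq_matI)
    fix i j assume "i < dim_row B'" "j < dim_col B'"
    then show "B $$ (i, j) = B' $$ (i, j)"
      using arg_cong[OF eq, of "\<lambda>M. M $$ (r1 + i, j)"] assms by (simp add: append_rows_def)
  qed (use assms in auto)
qed auto

text \<open>A maximal independent set of columns has as many elements as the rank, here the
  dimension of the whole space, so it is already a basis.\<close>

lemma (in vec_space) full_row_rank_col_space: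
  assumes A: "A \<in> carrier_mat n m" and full: "rank A = n"
  shows "col_space A = carrier_vec n"
proof -
  let ?S = "set (cols A)"
  have S: "?S \<subseteq> carrier_vec n" using A cols_dim by blast
  obtain B where B: "maximal B (\<lambda>C. C \<subseteq> ?S \<and> lin_indpt C)"
    using maximal_exists[of "\<lambda>C. C \<subseteq> ?S \<and> lin_indpt C" "card ?S" "{}"]
    by (meson List.finite_set card_mono empty_iff empty_subsetI finite_lin_indpt2 rev_finite_subset)
  then have BS: "B \<subseteq> ?S" "lin_indpt B" by (auto simp: maximal_def)
  have "card B = dim" using rank_card_indpt[OF A B] full dim_is_n by simp
  then have "basis B" using BS S
    by (intro dim_li_is_basis) (auto simp: finite_subset)
  then have "carrier_vec n \<subseteq> span ?S" using span_is_monotone[OF BS(1)] by (auto simp: basis_def)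
  then show ?thesis using span_closed[of ?S] S by (auto simp: col_space_def)
qed

text \<open>Every unit vector lies in the column space; solutions \<open>x i\<close> of the
  resulting linear systems, taken as columns, form the right inverse.\<close>

lemma full_row_rank_right_inverse:
  fixes A :: "'a :: field mat"
  assumes A: "A \<in> carrier_mat r m" and full: "vec_space.rank r A = r"
  shows "\<exists>S \<in> carrier_mat m r. A * S = 1\<^sub>m r"
proof -
  have "\<exists>x. x \<in> carrier_vec m \<and> A *\<^sub>v x = unit_vec r i" for i
  proof -
    have "unit_vec r i \<in> vec_space.col_space r A"
      using vec_space.full_row_rank_col_space[OF A full] by simp
    then show ?thesis using A by (auto simp: vec_space.col_space_eq[OF A])
  qed
  then obtain x where x: "\<And>i. x i \<in> carrier_vec m" "\<And>i. A *\<^sub>v x i = unit_vec r i" by metis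
  let ?S = "mat_of_cols m (map x [0..<r])"
  have "A * ?S = 1\<^sub>m r"
  proof (rule eq_matI)
    fix i j assume ij: "i < dim_row (1\<^sub>m r :: 'a mat)" "j < dim_col (1\<^sub>m r :: 'a mat)"
    have "(A * ?S) $$ (i, j) = (A *\<^sub>v x j) $ i" using ij A x(1) by (simp add: col_mat_of_cols)
    then show "(A * ?S) $$ (i, j) = 1\<^sub>m r $$ (i, j)" using ij by (simp only: x) auto
  qed (use A in auto)
  then show ?thesis by (intro bexI[of _ ?S]) auto
qed

section \<open>Quadratic forms and positive definite block matrices\<close>

lemma scalar_prod_self_pos:
  fixes v :: "real vec"
  assumes "v \<in> carrier_vec n" "v \<noteq> 0\<^sub>v n"
  shows "0 < v \<bullet> v"
proof -
  obtain i where "i < n" "v $ i \<noteq> 0" using assms by (metis carrier_vecD eq_vecI index_zero_vec)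
  then have "0 < (\<Sum>j<n. v $ j * v $ j)" by (intro sum_pos2[of _ i]) (auto simp: not_sum_squares_lt_zero zero_less_mult_iff)
  then show ?thesis using assms by (simp add: scalar_prod_def atLeast0LessThan)
qed

lemma symmetric_form_commute:
  fixes P :: "real mat"
  assumes P: "P \<in> carrier_mat n n" "P\<^sup>T = P" and v: "v \<in> carrier_vec n" "w \<in> carrier_vec n"
  shows "v \<bullet> (P *\<^sub>v w) = w \<bullet> (P *\<^sub>v v)"
  using transpose_vec_mult_scalar[OF P(1) v(2,1)] P v comm_scalar_prod[of w n "P *\<^sub>v v"]
  by simp

lemma symmetric_form_add:
  fixes P :: "real mat"
  assumes P: "P \<in> carrier_mat n n" "P\<^sup>T = P" and v: "v \<in> carrier_vec n" "w \<in> carrier_vec n"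
  shows "(v + w) \<bullet> (P *\<^sub>v (v + w)) = v \<bullet> (P *\<^sub>v v) + 2 * (w \<bullet> (P *\<^sub>v v)) + w \<bullet> (P *\<^sub>v w)"
proof -
  have "P *\<^sub>v v \<in> carrier_vec n" "P *\<^sub>v w \<in> carrier_vec n" using P v by auto
  then show ?thesis
    using v P symmetric_form_commute[OF P v]
    by (simp add: mult_add_distrib_mat_vec scalar_prod_add_distrib[of _ n] add_scalar_prod_distrib[of _ n])
qed

lemma pos_def_mat_iff:
  assumes "P \<in> carrier_mat n n"
  shows "pos_def_mat P \<longleftrightarrow>
    P\<^sup>T = P \<and> (\<forall>v \<in> carrier_vec n. v \<noteq> 0\<^sub>v n \<longrightarrow> 0 < v \<bullet> (P *\<^sub>v v))"
  using assms by (auto simp: pos_def_mat_def)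

lemma pos_def_mat_det:
  assumes P: "P \<in> carrier_mat n n" "pos_def_mat P"
  shows "det P \<noteq> 0"
proof
  assume "det P = 0"
  then obtain v where "v \<in> carrier_vec n" "v \<noteq> 0\<^sub>v n" "P *\<^sub>v v = 0\<^sub>v n"
    using det_0_iff_vec_prod_zero[OF P(1)] by auto
  then show False using P by (force simp: pos_def_mat_iff)
qed

text \<open>Guarantees that \<open>mat_inverse\<close> returns \<open>Some\<close>, so that
  \<open>the\<close> in \<open>gain_of\<close> yields a genuine inverse.\<close>

lemma pos_def_mat_inverse:
  assumes P: "P \<in> carrier_mat n n" "pos_def_mat P"
  obtains R where "R \<in> carrier_mat n n" "mat_inverse P = Some R" "P * R = 1\<^sub>m n" "R * P = 1\<^sub>m n"
proof -
  have "P \<in> Units (ring_mat TYPE(real) n ())"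
    using det_non_zero_imp_unit[OF P(1) pos_def_mat_det[OF P]] .
  then obtain R where "mat_inverse P = Some R"
    using mat_inverse(1)[OF P(1), where b = "()"] by (cases "mat_inverse P") auto
  then show ?thesis using that mat_inverse(2)[OF P(1)] by blast
qed

text \<open>Vectors padded with zeros see only the block \<open>A\<close>. Applied to the matrix
  inequality, this makes \<open>X0 * Q\<close> positive definite and hence invertible.\<close>

lemma pos_def_mat_upper_left_block:
  assumes A: "A \<in> carrier_mat n n" and B: "B \<in> carrier_mat n m"
    and C: "C \<in> carrier_mat m n" and D: "D \<in> carrier_mat m m"
    and pd: "pos_def_mat (four_block_mat A B C D)" (is "pos_def_mat ?F")
  shows "pos_def_mat A"
proof -
  have F: "?F \<in> carrier_mat (n + m) (n + m)" using A D by auto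
  have "A\<^sup>T = A"
  proof (rule eq_matI)
    fix i j assume "i < dim_row A" "j < dim_col A"
    moreover have "?F $$ (j, i) = ?F\<^sup>T $$ (j, i)" using pd by (simp add: pos_def_mat_def)
    ultimately show "A\<^sup>T $$ (i, j) = A $$ (i, j)" using A D by simp
  qed (use A in auto)
  moreover have "0 < v \<bullet> (A *\<^sub>v v)" if v: "v \<in> carrier_vec n" "v \<noteq> 0\<^sub>v n" for v
  proof -
    have zero: "B *\<^sub>v 0\<^sub>v m = 0\<^sub>v n" "D *\<^sub>v 0\<^sub>v m = 0\<^sub>v m" using B D by auto
    have "v @\<^sub>v 0\<^sub>v m \<noteq> 0\<^sub>v (n + m)"
    proof
      assume "v @\<^sub>v 0\<^sub>v m = 0\<^sub>v (n + m)"
      also have "\<dots> = 0\<^sub>v n @\<^sub>v 0\<^sub>v m" by auto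
      finally show False using v append_vec_eq[of v n "0\<^sub>v n"] by auto
    qed
    then have "0 < (v @\<^sub>v 0\<^sub>v m) \<bullet> (?F *\<^sub>v (v @\<^sub>v 0\<^sub>v m))"
      using pd F v by (simp add: pos_def_mat_iff)
    also have "?F *\<^sub>v (v @\<^sub>v 0\<^sub>v m) = (A *\<^sub>v v) @\<^sub>v (C *\<^sub>v v)"
      using A B C D v zero by (subst four_block_mat_mult_vec[OF A B C D]) auto
    also have "(v @\<^sub>v 0\<^sub>v m) \<bullet> \<dots> = v \<bullet> (A *\<^sub>v v)"
      using A C v by (subst scalar_prod_append[of _ n _ m]) auto
    finally show ?thesis .
  qed
  ultimately show ?thesis using A by (simp add: pos_def_mat_iff)
qed

text \<open>
  Completing the square: the quadratic form of the block matrix at \<open>(r, w)\<close> is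
  \<open>(w + M\<^sup>T r) P (w + M\<^sup>T r) + r P r - (M\<^sup>T r) P (M\<^sup>T r)\<close>.
\<close>

lemma pos_def_block_iff:
  fixes M P :: "real mat"
  assumes M: "M \<in> carrier_mat n n" and P: "P \<in> carrier_mat n n"
  shows "pos_def_mat (four_block_mat P (M * P) (M * P)\<^sup>T P) \<longleftrightarrow> pos_def_mat P \<and>
    (\<forall>r \<in> carrier_vec n. r \<noteq> 0\<^sub>v n \<longrightarrow> (M\<^sup>T *\<^sub>v r) \<bullet> (P *\<^sub>v (M\<^sup>T *\<^sub>v r)) < r \<bullet> (P *\<^sub>v r))"
    (is "pos_def_mat ?F \<longleftrightarrow> _")
proof -
  have F: "?F \<in> carrier_mat (n + n) (n + n)" using M P by auto
  have form: "(r @\<^sub>v w) \<bullet> (?F *\<^sub>v (r @\<^sub>v w)) =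
      (w + M\<^sup>T *\<^sub>v r) \<bullet> (P *\<^sub>v (w + M\<^sup>T *\<^sub>v r)) + r \<bullet> (P *\<^sub>v r) - (M\<^sup>T *\<^sub>v r) \<bullet> (P *\<^sub>v (M\<^sup>T *\<^sub>v r))"
    if sym: "P\<^sup>T = P" and v: "r \<in> carrier_vec n" "w \<in> carrier_vec n" for r w
  proof -
    let ?s = "M\<^sup>T *\<^sub>v r"
    have s: "?s \<in> carrier_vec n" "P *\<^sub>v w \<in> carrier_vec n" "P *\<^sub>v r \<in> carrier_vec n" using M v P by auto
    have 1: "M * P *\<^sub>v w = M *\<^sub>v (P *\<^sub>v w)" using M P v by auto
    \<comment> \<open>Symmetry of \<open>P\<close> turns the lower left block into P M^T, so both
      mixed terms depend on \<open>r\<close> only through \<open>?s\<close>.\<close>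
    have 2: "(M * P)\<^sup>T *\<^sub>v r = P *\<^sub>v ?s" using M P v sym by (simp add: transpose_mult[OF M P])
    have c: "M *\<^sub>v (P *\<^sub>v w) \<in> carrier_vec n" "P *\<^sub>v ?s \<in> carrier_vec n" using M s P by auto
    have "(r @\<^sub>v w) \<bullet> (?F *\<^sub>v (r @\<^sub>v w)) =
        r \<bullet> (P *\<^sub>v r + M *\<^sub>v (P *\<^sub>v w)) + w \<bullet> (P *\<^sub>v ?s + P *\<^sub>v w)"
      by (subst four_block_mat_mult_vec[OF P _ _ P v])
        (use M P v s c in \<open>auto simp: scalar_prod_append[of _ n _ n] 1 2\<close>)
    also have "\<dots> = r \<bullet> (P *\<^sub>v r) + ?s \<bullet> (P *\<^sub>v w) + w \<bullet> (P *\<^sub>v ?s) + w \<bullet> (P *\<^sub>v w)"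
      using v s c transpose_vec_mult_scalar[OF M s(2) v(1)] by (simp add: scalar_prod_add_distrib[of _ n])
    finally show ?thesis
      using symmetric_form_add[OF P sym v(2) s(1)] symmetric_form_commute[OF P sym v(2) s(1)] by simp
  qed
  show ?thesis
  proof (intro iffI conjI ballI impI)
    assume pd: "pos_def_mat ?F"
    then show P_pd: "pos_def_mat P" using M P by (intro pos_def_mat_upper_left_block[of P n "M * P" n]) auto
    then have sym: "P\<^sup>T = P" using P by (simp add: pos_def_mat_iff)
    fix r :: "real vec" assume r: "r \<in> carrier_vec n" "r \<noteq> 0\<^sub>v n"
    let ?s = "M\<^sup>T *\<^sub>v r"
    have s: "?s \<in> carrier_vec n" "- ?s + ?s = 0\<^sub>v n" using M r by auto
    \<comment> \<open>The choice w = - M^T r makes the completed square vanish, leaving exactly the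
      claimed difference.\<close>
    have "r @\<^sub>v - ?s \<noteq> 0\<^sub>v (n + n)"
    proof
      assume "r @\<^sub>v - ?s = 0\<^sub>v (n + n)"
      also have "\<dots> = 0\<^sub>v n @\<^sub>v 0\<^sub>v n" by auto
      finally show False using r append_vec_eq[of r n "0\<^sub>v n"] by auto
    qed
    then have "0 < (r @\<^sub>v - ?s) \<bullet> (?F *\<^sub>v (r @\<^sub>v - ?s))"
      using pd F r s by (simp add: pos_def_mat_iff)
    then show "?s \<bullet> (P *\<^sub>v ?s) < r \<bullet> (P *\<^sub>v r)"
      using form[OF sym r(1), of "- ?s"] s P by simp
  next
    assume *: "pos_def_mat P \<and>
      (\<forall>r \<in> carrier_vec n. r \<noteq> 0\<^sub>v n \<longrightarrow> (M\<^sup>T *\<^sub>v r) \<bullet> (P *\<^sub>v (M\<^sup>T *\<^sub>v r)) < r \<bullet> (P *\<^sub>v r))"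
    then have sym: "P\<^sup>T = P" and pos: "\<And>v. v \<in> carrier_vec n \<Longrightarrow> v \<noteq> 0\<^sub>v n \<Longrightarrow> 0 < v \<bullet> (P *\<^sub>v v)"
      using P by (auto simp: pos_def_mat_iff)
    have nonneg: "0 \<le> v \<bullet> (P *\<^sub>v v)" if "v \<in> carrier_vec n" for v
      using pos[OF that] that P by (cases "v = 0\<^sub>v n") auto
    have "0 < v \<bullet> (?F *\<^sub>v v)" if v: "v \<in> carrier_vec (n + n)" "v \<noteq> 0\<^sub>v (n + n)" for v
    proof -
      obtain r w where rw: "r \<in> carrier_vec n" "w \<in> carrier_vec n" "v = r @\<^sub>v w"
        using v(1) by (metis vec_first_last_append vec_first_carrier vec_last_carrier)
      have s: "w + M\<^sup>T *\<^sub>v r \<in> carrier_vec n" using rw M by auto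
      show ?thesis
      proof (cases "r = 0\<^sub>v n")
        case True
        have "w \<noteq> 0\<^sub>v n" using v rw True by auto
        moreover have "M\<^sup>T *\<^sub>v 0\<^sub>v n = 0\<^sub>v n" "P *\<^sub>v 0\<^sub>v n = 0\<^sub>v n" using M P by auto
        ultimately show ?thesis using form[OF sym rw(1,2)] pos[of w] rw True by simp
      next
        case False
        then show ?thesis using form[OF sym rw(1,2)] nonneg[OF s] * rw by fastforce
      qed
    qed
    moreover have "?F\<^sup>T = ?F"
      by (subst transpose_four_block_mat[of _ n n _ n _ n]) (use M P sym in auto)
    ultimately show "pos_def_mat ?F" using F by (simp add: pos_def_mat_iff)
  qed
qed

section \<open>From a Lyapunov inequality to the eigenvalues\<close>

lemma mult_mat_vec_index_sum:
  fixes A :: "'a :: semiring_0 mat"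
  assumes "A \<in> carrier_mat r m" "v \<in> carrier_vec m" "i < r"
  shows "(A *\<^sub>v v) $ i = (\<Sum>j<m. A $$ (i, j) * v $ j)"
  using assms by (auto simp: scalar_prod_def atLeast0LessThan intro!: sum.cong)

text \<open>A matrix and its transpose have the same characteristic polynomial. This is needed
  because the block criterion yields a form decreasing along the transposed closed loop.\<close>

lemma asymptotically_stable_transpose:
  assumes "M \<in> carrier_mat n n"
  shows "asymptotically_stable M\<^sup>T \<longleftrightarrow> asymptotically_stable M"
proof -
  have "map_mat complex_of_real M \<in> carrier_mat n n" using assms by simp
  then have "eigenvalue (map_mat complex_of_real M)\<^sup>T z \<longleftrightarrow> eigenvalue (map_mat complex_of_real M) z" for z
    by (simp only: eigenvalue_root_char_poly[of _ n] transpose_carrier_mat char_poly_transpose_mat)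
  then show ?thesis by (simp add: asymptotically_stable_def map_mat_transpose)
qed

text \<open>
  For an eigenvector \<open>x + \<i> y\<close> of \<open>N\<close> with eigenvalue \<open>z\<close>, the cross terms cancel in
  \<open>(N x) P (N x) + (N y) P (N y) = |z|\<^sup>2 (x P x + y P y)\<close>.
\<close>

lemma asymptotically_stable_if_form_decreases:
  fixes N P :: "real mat"
  assumes N: "N \<in> carrier_mat n n" and P: "P \<in> carrier_mat n n" "pos_def_mat P"
    and dec: "\<And>r. r \<in> carrier_vec n \<Longrightarrow> r \<noteq> 0\<^sub>v n \<Longrightarrow> (N *\<^sub>v r) \<bullet> (P *\<^sub>v (N *\<^sub>v r)) < r \<bullet> (P *\<^sub>v r)"
  shows "asymptotically_stable N"
  unfolding asymptotically_stable_def
proof (intro allI impI)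
  fix z assume "eigenvalue (map_mat complex_of_real N) z"
  then obtain w where w: "w \<in> carrier_vec n" "w \<noteq> 0\<^sub>v n" "map_mat complex_of_real N *\<^sub>v w = z \<cdot>\<^sub>v w"
    using N by (auto simp: eigenvalue_def eigenvector_def)
  define x y where "x = map_vec Re w" and "y = map_vec Im w"
  have xy: "x \<in> carrier_vec n" "y \<in> carrier_vec n" using w by (auto simp: x_def y_def)
  have sym: "P\<^sup>T = P" and pos: "\<And>v. v \<in> carrier_vec n \<Longrightarrow> v \<noteq> 0\<^sub>v n \<Longrightarrow> 0 < v \<bullet> (P *\<^sub>v v)"
    using P by (auto simp: pos_def_mat_iff)
  \<comment> \<open>Row by row, real and imaginary parts can be taken: \<open>N\<close> acts on
    \<open>x\<close> and \<open>y\<close> by the real 2 x 2 matrix that represents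
    \<open>z\<close>.\<close>
  have eq: "(\<Sum>j<n. complex_of_real (N $$ (i, j)) * w $ j) = z * w $ i" if i: "i < n" for i
  proof -
    have "(\<Sum>j<n. complex_of_real (N $$ (i, j)) * w $ j) = (map_mat complex_of_real N *\<^sub>v w) $ i"
      using i w(1) N by (subst mult_mat_vec_index_sum[of _ n n]) auto
    then show ?thesis using w i by simp
  qed
  have Nx: "N *\<^sub>v x = Re z \<cdot>\<^sub>v x + (- Im z) \<cdot>\<^sub>v y"
  proof (rule eq_vecI)
    fix i assume "i < dim_vec (Re z \<cdot>\<^sub>v x + (- Im z) \<cdot>\<^sub>v y)"
    then have "i < n" using xy by simp
    then show "(N *\<^sub>v x) $ i = (Re z \<cdot>\<^sub>v x + (- Im z) \<cdot>\<^sub>v y) $ i"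
      using arg_cong[OF eq, of i Re] w xy mult_mat_vec_index_sum[OF N, of x i]
      by (simp add: x_def y_def)
  qed (use N xy in auto)
  have Ny: "N *\<^sub>v y = Im z \<cdot>\<^sub>v x + Re z \<cdot>\<^sub>v y"
  proof (rule eq_vecI)
    fix i assume "i < dim_vec (Im z \<cdot>\<^sub>v x + Re z \<cdot>\<^sub>v y)"
    then have "i < n" using xy by simp
    then show "(N *\<^sub>v y) $ i = (Im z \<cdot>\<^sub>v x + Re z \<cdot>\<^sub>v y) $ i"
      using arg_cong[OF eq, of i Im] w xy mult_mat_vec_index_sum[OF N, of y i]
      by (simp add: x_def y_def)
  qed (use N xy in auto)
  have Pxy: "P *\<^sub>v x \<in> carrier_vec n" "P *\<^sub>v y \<in> carrier_vec n" using P xy by auto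
  have comb: "(\<alpha> \<cdot>\<^sub>v x + \<beta> \<cdot>\<^sub>v y) \<bullet> (P *\<^sub>v (\<alpha> \<cdot>\<^sub>v x + \<beta> \<cdot>\<^sub>v y)) =
      \<alpha>\<^sup>2 * (x \<bullet> (P *\<^sub>v x)) + 2 * \<alpha> * \<beta> * (y \<bullet> (P *\<^sub>v x)) + \<beta>\<^sup>2 * (y \<bullet> (P *\<^sub>v y))" for \<alpha> \<beta>
    using symmetric_form_add[OF P(1) sym, of "\<alpha> \<cdot>\<^sub>v x" "\<beta> \<cdot>\<^sub>v y"] xy P Pxy
    by (simp add: mult_mat_vec[of P n n] power2_eq_square algebra_simps)
  let ?q = "x \<bullet> (P *\<^sub>v x) + y \<bullet> (P *\<^sub>v y)"
  have "(N *\<^sub>v x) \<bullet> (P *\<^sub>v (N *\<^sub>v x)) + (N *\<^sub>v y) \<bullet> (P *\<^sub>v (N *\<^sub>v y)) = (cmod z)\<^sup>2 * ?q"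
    unfolding Nx Ny comb cmod_power2 by (simp add: algebra_simps)
  \<comment> \<open>One of \<open>x\<close>, \<open>y\<close> may be zero, so only the weak
    inequality holds for both; strictness of the sum comes from the nonzero one.\<close>
  moreover have ge: "0 \<le> v \<bullet> (P *\<^sub>v v) \<and> (N *\<^sub>v v) \<bullet> (P *\<^sub>v (N *\<^sub>v v)) \<le> v \<bullet> (P *\<^sub>v v)" if "v \<in> carrier_vec n" for v
  proof (cases "v = 0\<^sub>v n")
    case True
    have "N *\<^sub>v 0\<^sub>v n = 0\<^sub>v n" "P *\<^sub>v 0\<^sub>v n = 0\<^sub>v n" using N P by auto
    then show ?thesis using True by simp
  next
    case False
    then show ?thesis using dec[OF that] pos[OF that] by simp
  qed
  moreover have "x \<noteq> 0\<^sub>v n \<or> y \<noteq> 0\<^sub>v n"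
  proof (rule ccontr)
    assume a: "\<not> (x \<noteq> 0\<^sub>v n \<or> y \<noteq> 0\<^sub>v n)"
    have "w = 0\<^sub>v n"
    proof (rule eq_vecI)
      fix i assume i: "i < dim_vec (0\<^sub>v n :: complex vec)"
      have "x $ i = 0" "y $ i = 0" using a i by auto
      then show "w $ i = 0\<^sub>v n $ i" using i w by (simp add: x_def y_def complex_eq_iff)
    qed (use w in auto)
    then show False using w by simp
  qed
  ultimately have "(cmod z)\<^sup>2 * ?q < 1 * ?q" "0 \<le> ?q"
    using ge[OF xy(1)] ge[OF xy(2)] dec[OF xy(1)] dec[OF xy(2)] by auto
  then have "(cmod z)\<^sup>2 < 1" by (meson mult_right_less_imp_less)
  then show "cmod z < 1" by (simp add: abs_square_less_1)
qed

section \<open>A Lyapunov form for every stable matrix\<close>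

lemma smult_pow_mat:
  fixes A :: "'a :: comm_semiring_1 mat"
  assumes A: "A \<in> carrier_mat n n"
  shows "(c \<cdot>\<^sub>m A) ^\<^sub>m k = c ^ k \<cdot>\<^sub>m (A ^\<^sub>m k)"
proof (induction k)
  case (Suc k)
  have "A ^\<^sub>m k \<in> carrier_mat n n" using A by simp
  then show ?case using Suc A
    by (auto simp: mult_smult_assoc_mat[of _ n n _ n] mult_smult_distrib[of _ n n _ n] mult_ac)
qed auto

text \<open>
  Powers of a matrix of spectral radius less than one are bounded; applied to \<open>t C\<close> for a
  suitable \<open>t > 1\<close>, this gives geometric decay of the powers of \<open>C\<close>.
\<close>

lemma asymptotically_stable_pow_small:
  fixes N :: "real mat"
  assumes N: "N \<in> carrier_mat n n" and stable: "asymptotically_stable N" and e: "0 < e"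
  shows "\<exists>m. \<forall>i<n. \<forall>j<n. \<bar>(N ^\<^sub>m m) $$ (i, j)\<bar> < e"
proof (cases "n = 0")
  \<comment> \<open>The spectral radius is attained at an eigenvalue only in positive dimension; for
    \<open>n = 0\<close> there are no entries to bound.\<close>
  case False
  let ?C = "map_mat complex_of_real N"
  have C: "?C \<in> carrier_mat n n" using N by simp
  define \<rho> where "\<rho> = spectral_radius ?C"
  have n: "0 < n" using False by simp
  have \<rho>: "0 \<le> \<rho>" "\<rho> < 1"
    using spectral_radius_mem_max(1)[OF C n] stable
    by (auto simp: \<rho>_def spectrum_def asymptotically_stable_def)
  \<comment> \<open>The reciprocal of the midpoint between \<rho> and 1: larger than 1, yet scaling
    by it keeps the spectral radius below 1.\<close>
  define t where "t = 2 / (1 + \<rho>)"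
  have t: "1 < t" "t * \<rho> < 1" using \<rho> by (auto simp: t_def field_simps)
  let ?D = "complex_of_real t \<cdot>\<^sub>m ?C"
  have D: "?D \<in> carrier_mat n n" using C by simp
  obtain z where z: "eigenvalue ?D z" "spectral_radius ?D = cmod z"
    using spectral_radius_mem_max(1)[OF D n] by (auto simp: spectrum_def)
  obtain v where v: "v \<in> carrier_vec n" "v \<noteq> 0\<^sub>v n" "?D *\<^sub>v v = z \<cdot>\<^sub>v v"
    using z(1) D by (auto simp: eigenvalue_def eigenvector_def)
  have "?C *\<^sub>v v = (z / t) \<cdot>\<^sub>v v"
  proof (rule eq_vecI)
    fix i assume i: "i < dim_vec ((z / complex_of_real t) \<cdot>\<^sub>v v)"
    have "complex_of_real t * (?C *\<^sub>v v) $ i = (?D *\<^sub>v v) $ i"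
      using i v(1) N mult_mat_vec_index_sum[OF C v(1), of i] mult_mat_vec_index_sum[OF D v(1), of i]
      by (simp add: sum_distrib_left mult.assoc del: index_mult_mat_vec)
    also have "\<dots> = z * v $ i" using i v by simp
    finally show "(?C *\<^sub>v v) $ i = ((z / complex_of_real t) \<cdot>\<^sub>v v) $ i"
      using i v t by (simp add: field_simps)
  qed (use C v in auto)
  then have "eigenvalue ?C (z / t)" using v C by (auto simp: eigenvalue_def eigenvector_def)
  then have "cmod (z / t) \<le> \<rho>"
    using spectral_radius_mem_max(2)[OF C n] by (auto simp: \<rho>_def spectrum_def)
  then have "cmod z \<le> t * \<rho>" using t by (simp add: norm_divide field_simps)
  then have "spectral_radius ?D < 1" using z t by simp
  then obtain c where c: "\<And>k. norm_bound (?D ^\<^sub>m k) c"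
    using spectral_radius_jnf_norm_bound_less_1_upper_triangular[OF D] by auto
  \<comment> \<open>The entries of (t N)^m are bounded by \<open>c\<close> for every m, so those of
    N^m are at most c / t^m, which drops below \<open>e\<close>.\<close>
  obtain m where m: "c / e < t ^ m" using real_arch_pow[OF t(1)] by blast
  have "\<bar>(N ^\<^sub>m m) $$ (i, j)\<bar> < e" if "i < n" "j < n" for i j
  proof -
    have "?D ^\<^sub>m m = complex_of_real t ^ m \<cdot>\<^sub>m map_mat complex_of_real (N ^\<^sub>m m)"
      using smult_pow_mat[OF C] of_real_hom.mat_hom_pow[OF N] by metis
    moreover have "N ^\<^sub>m m \<in> carrier_mat n n" using N by simp
    ultimately have "cmod (complex_of_real t ^ m * complex_of_real ((N ^\<^sub>m m) $$ (i, j))) \<le> c"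
      using c[of m] that N by (simp add: norm_bound_def)
    then have "t ^ m * \<bar>(N ^\<^sub>m m) $$ (i, j)\<bar> \<le> c" using t by (simp add: norm_mult norm_power)
    also have "c < t ^ m * e" using m e by (simp add: field_simps)
    finally show ?thesis using t by simp
  qed
  then show ?thesis by blast
qed simp

text \<open>The witness is \<open>\<Sum>k<m. (N\<^sup>T)\<^sup>k N\<^sup>k\<close>, a truncation of the solution of the Lyapunov equation.\<close>

lemma truncated_lyapunov_solution:
  fixes N :: "real mat"
  assumes N: "N \<in> carrier_mat n n"
  shows "\<exists>S \<in> carrier_mat n n. S\<^sup>T = S \<and> (\<forall>r \<in> carrier_vec n. 0 \<le> r \<bullet> (S *\<^sub>v r) \<and>
    r \<bullet> (S *\<^sub>v r) - (N *\<^sub>v r) \<bullet> (S *\<^sub>v (N *\<^sub>v r)) = r \<bullet> r - (N ^\<^sub>m m *\<^sub>v r) \<bullet> (N ^\<^sub>m m *\<^sub>v r))"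
proof (induction m)
  case 0
  have "0\<^sub>m n n *\<^sub>v r = 0\<^sub>v n" if "r \<in> carrier_vec n" for r :: "real vec"
    using that mult_mat_vec_index_sum[of "0\<^sub>m n n" n n r] by (intro eq_vecI) (auto simp del: index_mult_mat_vec)
  then show ?case using N by (intro bexI[of _ "0\<^sub>m n n"]) auto
next
  case (Suc m)
  then obtain S where S: "S \<in> carrier_mat n n" "S\<^sup>T = S"
    and nonneg: "\<And>r. r \<in> carrier_vec n \<Longrightarrow> 0 \<le> r \<bullet> (S *\<^sub>v r)"
    and IH: "\<And>r. r \<in> carrier_vec n \<Longrightarrow> r \<bullet> (S *\<^sub>v r) - (N *\<^sub>v r) \<bullet> (S *\<^sub>v (N *\<^sub>v r))
      = r \<bullet> r - (N ^\<^sub>m m *\<^sub>v r) \<bullet> (N ^\<^sub>m m *\<^sub>v r)" by blast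
  \<comment> \<open>The truncated sum gains one term: with S' = I + N^T S N, the induction
    hypothesis at N r makes the difference telescope.\<close>
  let ?S = "1\<^sub>m n + N\<^sup>T * (S * N)"
  have SN: "S * N \<in> carrier_mat n n" "N\<^sup>T * (S * N) \<in> carrier_mat n n" "N\<^sup>T \<in> carrier_mat n n"
    using S N by auto
  have form: "r \<bullet> (?S *\<^sub>v r) = r \<bullet> r + (N *\<^sub>v r) \<bullet> (S *\<^sub>v (N *\<^sub>v r))" if r: "r \<in> carrier_vec n" for r
  proof -
    have Nr: "N *\<^sub>v r \<in> carrier_vec n" "S *\<^sub>v (N *\<^sub>v r) \<in> carrier_vec n"
      "N\<^sup>T *\<^sub>v (S *\<^sub>v (N *\<^sub>v r)) \<in> carrier_vec n" using N S r by auto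
    have "?S *\<^sub>v r = r + N\<^sup>T *\<^sub>v (S *\<^sub>v (N *\<^sub>v r))"
      using r SN S N by (simp add: add_mult_distrib_mat_vec[of _ n n] assoc_mult_mat_vec[of _ n n _ n])
    then show ?thesis
      using transpose_vec_mult_scalar[OF SN(3) Nr(2) r] r Nr
      by (simp add: scalar_prod_add_distrib[of _ n])
  qed
  have sq: "0 \<le> r \<bullet> r" if "r \<in> carrier_vec n" for r :: "real vec"
    using scalar_prod_self_pos[OF that] by (cases "r = 0\<^sub>v n") auto
  have "?S\<^sup>T = ?S"
  proof -
    have "(N\<^sup>T * (S * N))\<^sup>T = (S * N)\<^sup>T * N" using transpose_mult[OF SN(3,1)] by simp
    also have "\<dots> = N\<^sup>T * (S * N)"
      using transpose_mult[OF S(1) N] S N SN by (simp add: assoc_mult_mat[of _ n n _ n _ n])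
    finally show ?thesis using SN by (simp add: transpose_add[of _ n n])
  qed
  moreover have "0 \<le> r \<bullet> (?S *\<^sub>v r) \<and> r \<bullet> (?S *\<^sub>v r) - (N *\<^sub>v r) \<bullet> (?S *\<^sub>v (N *\<^sub>v r))
      = r \<bullet> r - (N ^\<^sub>m Suc m *\<^sub>v r) \<bullet> (N ^\<^sub>m Suc m *\<^sub>v r)" if r: "r \<in> carrier_vec n" for r
  proof -
    have Nr: "N *\<^sub>v r \<in> carrier_vec n" using N r by simp
    have "N ^\<^sub>m Suc m *\<^sub>v r = N ^\<^sub>m m *\<^sub>v (N *\<^sub>v r)"
      using N r by (simp add: assoc_mult_mat_vec[of _ n n _ n])
    then show ?thesis using form[OF r] form[OF Nr] IH[OF Nr] nonneg[OF Nr] sq[OF r] by simp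
  qed
  moreover have "?S \<in> carrier_mat n n" using SN by simp
  ultimately show ?case by blast
qed

text \<open>For the truncated sum S with m terms, the decrease of the form along \<open>N\<close> is
  |r|^2 - |N^m r|^2, which is positive once N^m is a strict contraction. A finite sum therefore
  suffices, and no infinite series has to converge.\<close>

lemma asymptotically_stable_form_exists:
  fixes N :: "real mat"
  assumes N: "N \<in> carrier_mat n n" and stable: "asymptotically_stable N"
  shows "\<exists>P \<in> carrier_mat n n. pos_def_mat P \<and>
    (\<forall>r \<in> carrier_vec n. r \<noteq> 0\<^sub>v n \<longrightarrow> (N *\<^sub>v r) \<bullet> (P *\<^sub>v (N *\<^sub>v r)) < r \<bullet> (P *\<^sub>v r))"
proof -
  \<comment> \<open>Entries below \<open>e\<close> give |N^m r|^2 <= n (n e)^2 |r|^2, and n (n e)^2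
    = n^3 / (1 + n)^4 < 1.\<close>
  define e where "e = 1 / (1 + real n) ^ 2"
  have e: "0 < e" by (simp add: e_def)
  obtain m where m: "\<And>i j. i < n \<Longrightarrow> j < n \<Longrightarrow> \<bar>(N ^\<^sub>m m) $$ (i, j)\<bar> < e"
    using asymptotically_stable_pow_small[OF N stable e] by blast
  let ?A = "N ^\<^sub>m m"
  have A: "?A \<in> carrier_mat n n" using N by simp
  obtain S where S: "S \<in> carrier_mat n n" "S\<^sup>T = S"
    and nonneg: "\<And>r. r \<in> carrier_vec n \<Longrightarrow> 0 \<le> r \<bullet> (S *\<^sub>v r)"
    and diff: "\<And>r. r \<in> carrier_vec n \<Longrightarrow> r \<bullet> (S *\<^sub>v r) - (N *\<^sub>v r) \<bullet> (S *\<^sub>v (N *\<^sub>v r))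
      = r \<bullet> r - (?A *\<^sub>v r) \<bullet> (?A *\<^sub>v r)"
    using truncated_lyapunov_solution[OF N, of m] by blast
  have small: "(?A *\<^sub>v r) \<bullet> (?A *\<^sub>v r) < r \<bullet> r" if r: "r \<in> carrier_vec n" "r \<noteq> 0\<^sub>v n" for r
  proof -
    define R where "R = r \<bullet> r"
    have R: "0 < R" using scalar_prod_self_pos[OF r] by (simp add: R_def)
    have r_le: "\<bar>r $ j\<bar> \<le> sqrt R" if "j < n" for j
    proof -
      have "r $ j * r $ j \<le> (\<Sum>k<n. r $ k * r $ k)"
        using that by (intro member_le_sum) auto
      then show ?thesis using r by (intro real_le_rsqrt) (simp add: R_def scalar_prod_def atLeast0LessThan power2_eq_square)
    qed
    have entry: "\<bar>(?A *\<^sub>v r) $ i\<bar> \<le> n * (e * sqrt R)" if "i < n" for i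
    proof -
      have "\<bar>(?A *\<^sub>v r) $ i\<bar> = \<bar>\<Sum>j<n. ?A $$ (i, j) * r $ j\<bar>"
        using mult_mat_vec_index_sum[OF A r(1) that] by simp
      also have "\<dots> \<le> (\<Sum>j<n. \<bar>?A $$ (i, j) * r $ j\<bar>)" by (rule sum_abs)
      also have "\<dots> \<le> (\<Sum>j<n. e * sqrt R)"
      proof (rule sum_mono)
        fix j assume "j \<in> {..<n}"
        then show "\<bar>?A $$ (i, j) * r $ j\<bar> \<le> e * sqrt R"
          unfolding abs_mult using r_le m[OF that] e by (intro mult_mono) (auto simp: less_imp_le)
      qed
      finally show ?thesis by simp
    qed
    have "(?A *\<^sub>v r) \<bullet> (?A *\<^sub>v r) = (\<Sum>i<n. ((?A *\<^sub>v r) $ i)\<^sup>2)"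
    proof -
      have "?A *\<^sub>v r \<in> carrier_vec n" using A r by simp
      from carrier_vecD[OF this] show ?thesis
        unfolding scalar_prod_def by (simp only: atLeast0LessThan power2_eq_square)
    qed
    also have "\<dots> \<le> (\<Sum>i<n. (n * (e * sqrt R))\<^sup>2)"
      using entry by (intro sum_mono) (metis abs_ge_zero lessThan_iff power2_abs power_mono)
    also have "\<dots> = (n * (n * e)\<^sup>2) * R" using R by (simp add: power_mult_distrib)
    also have "\<dots> < 1 * R"
    proof -
      have "n * (real n)\<^sup>2 = real n ^ 3" by (simp add: power2_eq_square power3_eq_cube)
      also have "\<dots> < (1 + real n) ^ 3" by (intro power_strict_mono) auto
      also have "\<dots> \<le> (1 + real n) ^ 4" by (intro power_increasing) auto
      finally have "n * (real n)\<^sup>2 < (1 + real n) ^ 4" .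
      then have "n * (n * e)\<^sup>2 < 1" by (simp add: e_def power_divide field_simps flip: power_mult)
      then show ?thesis using R by (rule mult_strict_right_mono)
    qed
    finally show ?thesis by (simp add: R_def)
  qed
  have dec: "(N *\<^sub>v r) \<bullet> (S *\<^sub>v (N *\<^sub>v r)) < r \<bullet> (S *\<^sub>v r)" if "r \<in> carrier_vec n" "r \<noteq> 0\<^sub>v n" for r
    using diff[OF that(1)] small[OF that] by simp
  have "pos_def_mat S"
    unfolding pos_def_mat_iff[OF S(1)]
  proof (intro conjI ballI impI)
    fix r :: "real vec" assume r: "r \<in> carrier_vec n" "r \<noteq> 0\<^sub>v n"
    \<comment> \<open>Strict decrease and semidefiniteness combine: the form at r strictly exceeds
      its value at N r, which is nonnegative.\<close>
    show "0 < r \<bullet> (S *\<^sub>v r)" using dec[OF r] nonneg[of "N *\<^sub>v r"] N r by simp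
  qed (rule S(2))
  then show ?thesis using S dec by blast
qed

section \<open>Data matrices and the data-based closed loop\<close>

text \<open>Column \<open>k\<close> is the state update of the plant at time \<open>k\<close>. This
  single matrix identity is what later eliminates the unknown \<open>sys_A\<close> in favour of
  data.\<close>

lemma data_X1_eq:
  assumes n: "n \<ge> 1" and data: "\<And>k. 0 \<le> k \<Longrightarrow> k < int T \<Longrightarrow> difference_eq n a b u y k"
  shows "data_X1 n T u y = sys_A n a b * data_X0 n T u y + sys_B n * data_U T u"
proof (rule mat_col_eqI)
  fix k assume "k < dim_col (sys_A n a b * data_X0 n T u y + sys_B n * data_U T u)"
  then have k: "k < T" by (simp add: data_U_def)
  let ?w = "vec 1 (\<lambda>_. u (int k))"
  have c: "sys_A n a b \<in> carrier_mat (2*n) (2*n)" "sys_B n \<in> carrier_mat (2*n) 1"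
    "data_X0 n T u y \<in> carrier_mat (2*n) T" "data_U T u \<in> carrier_mat 1 T"
    by (auto simp: sys_A_def sys_B_def data_X0_def data_U_def)
  have "col (data_U T u) k = ?w" using k by (auto simp: data_U_def)
  moreover have "col (data_X0 n T u y) k = state n u y (int k)"
    using k by (auto simp: data_X0_def col_mat_of_cols state_def)
  ultimately have "col (sys_A n a b * data_X0 n T u y + sys_B n * data_U T u) k
      = sys_A n a b *\<^sub>v state n u y (int k) + sys_B n *\<^sub>v ?w"
    using col_add[of "sys_A n a b * data_X0 n T u y" "2*n" T "sys_B n * data_U T u" k]
      col_mult2[OF c(1,3) k] col_mult2[OF c(2,4) k] k mult_carrier_mat[OF c(1,3)] mult_carrier_mat[OF c(2,4)]
    by (simp only:)
  also have "\<dots> = state n u y (int k + 1)"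
    using state_step_iff[OF n, of ?w u y "int k" a b] data[of "int k"] k by simp
  also have "\<dots> = col (data_X1 n T u y) k"
    using k by (auto simp: data_X1_def col_mat_of_cols state_def)
  finally show "col (data_X1 n T u y) k = col (sys_A n a b * data_X0 n T u y + sys_B n * data_U T u) k" ..
qed (auto simp: data_X1_def data_U_def sys_B_def)

text \<open>The entries of the row can be read off as coefficients, so the gain computed from
  \<open>Q\<close> always belongs to a controller of the required form.\<close>

lemma controller_row_exists:
  assumes "K \<in> carrier_mat 1 (2 * n)"
  shows "\<exists>c d. controller_row n c d = K"
proof (intro exI)
  show "controller_row n (\<lambda>i. - K $$ (0, n + i - 1)) (\<lambda>i. K $$ (0, i - 1)) = K"
    using assms by (intro eq_matI) (auto simp: controller_row_def)
qed

theorem theorem8: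
  fixes n T :: nat
    and a b :: "nat \<Rightarrow> real"
    and u y :: "int \<Rightarrow> real"
    and U X0 X1 :: "real mat"
  assumes n: "n \<ge> 1"
    and coprime: "coprime (den_poly n a) (num_poly n b)"
    and data: "\<And>k. 0 \<le> k \<Longrightarrow> k < int T \<Longrightarrow> difference_eq n a b u y k"
    and U: "U = data_U T u"
    and X0: "X0 = data_X0 n T u y"
    and X1: "X1 = data_X1 n T u y"
    and rank: "vec_space.rank (2 * n + 1) (U @\<^sub>r X0) = 2 * n + 1"
  shows
    "(\<forall>c d.
       (\<exists>G \<in> carrier_mat T (2 * n). controller_row n c d @\<^sub>r 1\<^sub>m (2 * n) = (U @\<^sub>r X0) * G) \<and>
       (\<forall>G \<in> carrier_mat T (2 * n). controller_row n c d @\<^sub>r 1\<^sub>m (2 * n) = (U @\<^sub>r X0) * G \<longrightarrow>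
          closed_loop n a b c d = X1 * G \<and>
          (\<forall>\<chi>. trajectory (closed_loop n a b c d) \<chi> \<longleftrightarrow> trajectory (X1 * G) \<chi>)))
     \<and>
     (\<forall>Q \<in> carrier_mat T (2 * n). lmi X0 X1 Q \<longrightarrow>
       invertible_mat (X0 * Q) \<and>
       (\<exists>c d. controller_row n c d = gain_of U X0 Q) \<and>
       (\<forall>c d. controller_row n c d = gain_of U X0 Q \<longrightarrow> stabilizes n a b c d))
     \<and>
     (\<forall>c d. stabilizes n a b c d \<longrightarrow>
       (\<exists>Q \<in> carrier_mat T (2 * n). lmi X0 X1 Q \<and> controller_row n c d = gain_of U X0 Q))"
proof -
  define N where "N = 2 * n"
  have c: "U \<in> carrier_mat 1 T" "X0 \<in> carrier_mat N T" "X1 \<in> carrier_mat N T"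
    "sys_A n a b \<in> carrier_mat N N" "sys_B n \<in> carrier_mat N 1"
    by (auto simp: U X0 X1 N_def data_U_def data_X0_def data_X1_def sys_A_def sys_B_def)
  have K: "controller_row n c d \<in> carrier_mat 1 N" for c d by (simp add: controller_row_def N_def)
  have W: "U @\<^sub>r X0 \<in> carrier_mat (N + 1) T" using carrier_append_rows[OF c(1,2)] by simp
  have X1_eq: "X1 = sys_A n a b * X0 + sys_B n * U"
    unfolding U X0 X1 by (rule data_X1_eq[OF n data])
  have G_iff: "controller_row n c d @\<^sub>r 1\<^sub>m N = (U @\<^sub>r X0) * G \<longleftrightarrow> U * G = controller_row n c d \<and> X0 * G = 1\<^sub>m N"
    if G: "G \<in> carrier_mat T N" for c d G
  proof -
    have UG: "U * G \<in> carrier_mat 1 N" and XG: "X0 * G \<in> carrier_mat N N" using c G by auto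
    show ?thesis
      unfolding append_rows_mult[OF c(1,2) G] append_rows_inject[OF K UG one_carrier_mat XG] by auto
  qed
  have G_exists: "\<exists>G \<in> carrier_mat T N. controller_row n c d @\<^sub>r 1\<^sub>m N = (U @\<^sub>r X0) * G" for c d
  proof -
    obtain S where S: "S \<in> carrier_mat T (N + 1)" "(U @\<^sub>r X0) * S = 1\<^sub>m (N + 1)"
      using full_row_rank_right_inverse[OF W] rank by (auto simp: N_def)
    have KI: "controller_row n c d @\<^sub>r 1\<^sub>m N \<in> carrier_mat (N + 1) N"
      using carrier_append_rows[OF K one_carrier_mat] by simp
    \<comment> \<open>A right inverse times the prescribed stacked matrix is a suitable
      \<open>G\<close>.\<close>
    then have "(U @\<^sub>r X0) * (S * (controller_row n c d @\<^sub>r 1\<^sub>m N)) = controller_row n c d @\<^sub>r 1\<^sub>m N"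
      using assoc_mult_mat[OF W S(1) KI] S(2) by simp
    then show ?thesis using S KI by (metis mult_carrier_mat)
  qed
  have closed: "closed_loop n a b c d = X1 * G"
    if G: "G \<in> carrier_mat T N" "U * G = controller_row n c d" "X0 * G = 1\<^sub>m N" for c d G
  proof -
    have "X1 * G = sys_A n a b * (X0 * G) + sys_B n * (U * G)"
      unfolding X1_eq using c G(1)
      by (subst add_mult_distrib_mat[of _ N T]) (auto simp: assoc_mult_mat[of _ N])
    then show ?thesis using G c by (simp add: closed_loop_def)
  qed
  have cl: "closed_loop n a b c d \<in> carrier_mat N N" for c d
    using c K by (auto simp: closed_loop_def)
  have lmi_iff: "lmi X0 X1 Q \<longleftrightarrow> pos_def_mat (four_block_mat (X0 * Q) (X1 * Q) (X1 * Q)\<^sup>T (X0 * Q))"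
    if "Q \<in> carrier_mat T N" for Q
    unfolding lmi_def using transpose_mult[OF c(3) that] by simp

  have part2: "invertible_mat (X0 * Q) \<and> (\<exists>c d. controller_row n c d = gain_of U X0 Q) \<and>
      (\<forall>c d. controller_row n c d = gain_of U X0 Q \<longrightarrow> stabilizes n a b c d)"
    if Q: "Q \<in> carrier_mat T N" and lmi: "lmi X0 X1 Q" for Q
  proof -
    have P: "X0 * Q \<in> carrier_mat N N" "X1 * Q \<in> carrier_mat N N" using c Q by auto
    have pd: "pos_def_mat (X0 * Q)"
      using lmi P unfolding lmi_iff[OF Q] by (intro pos_def_mat_upper_left_block[OF P _ P(1)]) auto
    obtain R where R: "R \<in> carrier_mat N N" "mat_inverse (X0 * Q) = Some R"
      "X0 * Q * R = 1\<^sub>m N" "R * (X0 * Q) = 1\<^sub>m N"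
      using pos_def_mat_inverse[OF P(1) pd] .
    \<comment> \<open>With \<open>R\<close> the inverse of \<open>X0 * Q\<close>, the matrix
      \<open>Q * R\<close> is a solution \<open>G\<close> of the stacked equation for the gain of
      \<open>Q\<close>.\<close>
    have G: "Q * R \<in> carrier_mat T N" using Q R by simp
    have UG: "U * (Q * R) = gain_of U X0 Q" and XG: "X0 * (Q * R) = 1\<^sub>m N"
      using c Q R by (simp_all add: gain_of_def assoc_mult_mat[of _ _ T _ N _ N])
    have "invertible_mat (X0 * Q)"
      using R P(1) c Q by (auto simp: invertible_mat_def inverts_mat_def intro!: exI[of _ R])
    moreover have "gain_of U X0 Q \<in> carrier_mat 1 (2 * n)"
      using UG c G by (metis N_def mult_carrier_mat)
    moreover have "stabilizes n a b c d" if "controller_row n c d = gain_of U X0 Q" for c d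
    proof -
      let ?M = "closed_loop n a b c d"
      have "?M = X1 * (Q * R)" using closed[OF G _ XG] UG that by simp
      \<comment> \<open>Cancelling \<open>R\<close> gives M P = X1 Q for P = X0 Q, which puts the
        inequality into the form of the block criterion.\<close>
      then have "?M * (X0 * Q) = X1 * Q * (R * (X0 * Q))"
        using assoc_mult_mat[OF c(3) Q R(1)] assoc_mult_mat[OF P(2) R(1) P(1)] by simp
      then have "?M * (X0 * Q) = X1 * Q" using right_mult_one_mat[OF P(2)] R(4) by simp
      then have "pos_def_mat (four_block_mat (X0 * Q) (?M * (X0 * Q)) (?M * (X0 * Q))\<^sup>T (X0 * Q))"
        using lmi lmi_iff[OF Q] by simp
      then have "asymptotically_stable ?M\<^sup>T"
        using pos_def_block_iff[OF cl P(1)] P cl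
        by (intro asymptotically_stable_if_form_decreases[of _ N "X0 * Q"]) auto
      then show ?thesis
        using asymptotically_stable_transpose[OF cl] by (simp add: stabilizes_def)
    qed
    ultimately show ?thesis using controller_row_exists by blast
  qed

  have part3: "\<exists>Q \<in> carrier_mat T N. lmi X0 X1 Q \<and> controller_row n c d = gain_of U X0 Q"
    if stab: "stabilizes n a b c d" for c d
  proof -
    let ?M = "closed_loop n a b c d"
    have "asymptotically_stable ?M\<^sup>T"
      using stab asymptotically_stable_transpose[OF cl] by (simp add: stabilizes_def)
    then obtain P where P: "P \<in> carrier_mat N N" "pos_def_mat P"
      and dec: "\<And>r. r \<in> carrier_vec N \<Longrightarrow> r \<noteq> 0\<^sub>v N \<Longrightarrow>
        (?M\<^sup>T *\<^sub>v r) \<bullet> (P *\<^sub>v (?M\<^sup>T *\<^sub>v r)) < r \<bullet> (P *\<^sub>v r)"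
      using asymptotically_stable_form_exists[of "?M\<^sup>T" N] cl by auto
    obtain G where G: "G \<in> carrier_mat T N" "U * G = controller_row n c d" "X0 * G = 1\<^sub>m N"
      using G_exists G_iff by blast
    obtain R where R: "R \<in> carrier_mat N N" "mat_inverse P = Some R" "P * R = 1\<^sub>m N"
      using pos_def_mat_inverse[OF P] .
    \<comment> \<open>Since X0 G = I, the witness G P gives X0 Q = P; its gain is then K P P^-1 =
      K.\<close>
    have Q: "G * P \<in> carrier_mat T N" using G P by simp
    have X0Q: "X0 * (G * P) = P" and X1Q: "X1 * (G * P) = ?M * P" and UQ: "U * (G * P) = controller_row n c d * P"
      using assoc_mult_mat[OF _ G(1) P(1)] c P G closed[OF G] by (metis left_mult_one_mat)+
    have "lmi X0 X1 (G * P)"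
      unfolding lmi_iff[OF Q] X0Q X1Q using pos_def_block_iff[OF cl P(1)] P dec by simp
    moreover have "gain_of U X0 (G * P) = controller_row n c d"
      using R assoc_mult_mat[OF K P(1) R(1)] right_mult_one_mat[OF K] by (simp add: gain_of_def X0Q UQ)
    ultimately show ?thesis using Q by metis
  qed

  have part1: "closed_loop n a b c d = X1 * G"
    if "G \<in> carrier_mat T N" "controller_row n c d @\<^sub>r 1\<^sub>m N = (U @\<^sub>r X0) * G" for c d G
    using that G_iff closed by blast
  show ?thesis
    unfolding N_def[symmetric]
    by (intro conjI allI ballI impI G_exists)
      (simp_all add: part1 part2 part3)
qed

end
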